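(* Let $\mathcal{G}=(\mathcal{V},\mathcal{E},w)$ be a strongly connected directed graph with positive edge weights and let $S_0\subseteq\mathcal{V}$ be a fixed non-empty set of opinion-$0$ leaders. For both the absolute leader system and the influenced leader system on $\mathcal{G}$, the average opinion $\mu(S_1)$, as a set function of $S_1\subseteq\mathcal{V}\setminus S_0$, is monotone and submodular. That is, for all $S_1\subseteq T_1\subseteq\mathcal{V}\setminus S_0$ we have $\mu(S_1)\le\mu(T_1)$, and for every $u\in\mathcal{V}\setminus(S_0\cup T_1)$, $$\mu(T_1\cup\{u\})-\mu(T_1)\le\mu(S_1\cup\{u\})-\mu(S_1).$$
   Context: For a weighted directed graph, $A_{u,v}=w(u,v)$ if $(u,v)\in\mathcal{E}$ and $0$ otherwise, $D$ is the diagonal out-degree matrix $D_{u,u}=\sum_vA_{u,v}$, $L=D-A$, $n=|\mathcal{V}|$. Let $S=S_0\cup S_1$ with $S_0\cap S_1=\emptyset$. Absolute leader system: with $F=\mathcal{V}\setminus S$, leaders hold constant values and followers follow $\dot x_F=-L_{F,F}x_F-L_{F,S}x_S$; the steady state is $\hat x_v=0$ on $S_0$, $\hat x_v=1$ on $S_1$, $\hat x_F=-(L_{F,F})^{-1}L_{F,S}\hat x_S$. Influenced leader system: each node $v$ has a fixed stubbornness $\kappa_v>0$, used if $v$ is a leader; with $K=\mathrm{diag}(\kappa_v)$ and $E^T$ the diagonal $0/1$ indicator matrix of a node set $T$, the dynamics are $\dot x=-(L+E^SK)x+E^{S_1}K\mathbf{1}$, with steady state $\hat x=(L+E^SK)^{-1}E^{S_1}K\mathbf{1}$.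 In both systems the average opinion is $\mu(S_1)=\frac1n\sum_{v\in\mathcal{V}}\hat x_v$. *)

theory Defs
  imports "HOL-Analysis.Analysis"
begin

text \<open>
  The node set is a finite type \<open>'v\<close>, so that $n$ is \<open>CARD('v)\<close>. A weighted directed graph is a
  set of arcs together with a weight function, whose values off the arcs are irrelevant.
  Self-loops are not excluded; they cancel in the Laplacian.
\<close>

definition strongly_connected :: "('v \<times> 'v) set \<Rightarrow> bool" where
  "strongly_connected E \<longleftrightarrow> (\<forall>u v. (u, v) \<in> E\<^sup>*)"

definition diag_matrix :: "('v::finite \<Rightarrow> real) \<Rightarrow> real^'v^'v" where
  "diag_matrix f = (\<chi> i j. if i = j then f i else 0)"

definition indicator_matrix :: "'v::finite set \<Rightarrow> real^'v^'v" where
  "indicator_matrix T = diag_matrix (\<lambda>v. if v \<in> T then 1 else 0)"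

definition adjacency :: "('v::finite \<times> 'v) set \<Rightarrow> ('v \<Rightarrow> 'v \<Rightarrow> real) \<Rightarrow> real^'v^'v" where
  "adjacency E w = (\<chi> u v. if (u, v) \<in> E then w u v else 0)"

definition out_degree_matrix :: "('v::finite \<times> 'v) set \<Rightarrow> ('v \<Rightarrow> 'v \<Rightarrow> real) \<Rightarrow> real^'v^'v" where
  "out_degree_matrix E w = diag_matrix (\<lambda>u. \<Sum>v\<in>UNIV. adjacency E w $ u $ v)"

definition laplacian :: "('v::finite \<times> 'v) set \<Rightarrow> ('v \<Rightarrow> 'v \<Rightarrow> real) \<Rightarrow> real^'v^'v" where
  "laplacian E w = out_degree_matrix E w - adjacency E w"

text \<open>
  Blocks indexed by node subsets are kept inside the full index type, padded by zeros.
  \<open>block_mult_vec M I J x\<close> is $M_{I,J}\,x_J$, and \<open>is_block_inverse F M N\<close> says that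
  the block $N_{F,F}$ is the two-sided inverse of $M_{F,F}$. The padding makes \<open>N\<close> unique.
\<close>

definition block_mult_vec :: "real^'v^'v \<Rightarrow> 'v::finite set \<Rightarrow> 'v set \<Rightarrow> real^'v \<Rightarrow> real^'v" where
  "block_mult_vec M I J x = (\<chi> i. if i \<in> I then \<Sum>j\<in>J. M $ i $ j * x $ j else 0)"

definition is_block_inverse :: "'v::finite set \<Rightarrow> real^'v^'v \<Rightarrow> real^'v^'v \<Rightarrow> bool" where
  "is_block_inverse F M N \<longleftrightarrow>
     (\<forall>i j. i \<notin> F \<or> j \<notin> F \<longrightarrow> N $ i $ j = 0) \<and>
     (\<forall>i\<in>F. \<forall>j\<in>F. (\<Sum>k\<in>F. M $ i $ k * N $ k $ j) = (if i = j then 1 else 0)) \<and>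
     (\<forall>i\<in>F. \<forall>j\<in>F. (\<Sum>k\<in>F. N $ i $ k * M $ k $ j) = (if i = j then 1 else 0))"

definition block_inverse :: "'v::finite set \<Rightarrow> real^'v^'v \<Rightarrow> real^'v^'v" where
  "block_inverse F M = (THE N. is_block_inverse F M N)"

lemma is_block_inverse_unique:
  assumes N: "is_block_inverse F M N" and N': "is_block_inverse F M N'"
  shows "N = N'"
proof -
  have "N $ i $ j = N' $ i $ j" for i j
  proof (cases "i \<in> F \<and> j \<in> F")
    case True
    then have i: "i \<in> F" and j: "j \<in> F" by auto
    have "N $ i $ j = (\<Sum>k\<in>F. N $ i $ k * (if k = j then 1 else 0))"
      using j by (simp add: if_distrib cong: if_cong)
    also have "\<dots> = (\<Sum>k\<in>F. N $ i $ k * (\<Sum>l\<in>F. M $ k $ l * N' $ l $ j))"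
      using N' j by (intro sum.cong) (auto simp: is_block_inverse_def)
    also have "\<dots> = (\<Sum>l\<in>F. (\<Sum>k\<in>F. N $ i $ k * M $ k $ l) * N' $ l $ j)"
      unfolding sum_distrib_left sum_distrib_right by (subst sum.swap) (simp add: mult.assoc)
    also have "\<dots> = (\<Sum>l\<in>F. (if i = l then 1 else 0) * N' $ l $ j)"
      using N i by (intro sum.cong) (auto simp: is_block_inverse_def)
    also have "\<dots> = N' $ i $ j"
      using i by (simp add: if_distrib if_distribR cong: if_cong)
    finally show ?thesis .
  next
    case False
    then show ?thesis using N N' by (auto simp: is_block_inverse_def)
  qed
  then show ?thesis by (simp add: vec_eq_iff)
qed

lemma block_inverse_eq: "is_block_inverse F M N \<Longrightarrow> block_inverse F M = N"
  unfolding block_inverse_def by (blast intro: the_equality is_block_inverse_unique)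

definition leader_values :: "'v::finite set \<Rightarrow> real^'v" where
  "leader_values S\<^sub>1 = (\<chi> v. if v \<in> S\<^sub>1 then 1 else 0)"

definition absolute_steady_state ::
    "('v::finite \<times> 'v) set \<Rightarrow> ('v \<Rightarrow> 'v \<Rightarrow> real) \<Rightarrow> 'v set \<Rightarrow> 'v set \<Rightarrow> real^'v" where
  "absolute_steady_state E w S\<^sub>0 S\<^sub>1 =
     (let S = S\<^sub>0 \<union> S\<^sub>1; F = UNIV - S; L = laplacian E w;
          x\<^sub>F = - block_mult_vec (block_inverse F L) F F
                  (block_mult_vec L F S (leader_values S\<^sub>1))
      in \<chi> v. if v \<in> S then leader_values S\<^sub>1 $ v else x\<^sub>F $ v)"

definition influenced_steady_state ::
    "('v::finite \<times> 'v) set \<Rightarrow> ('v \<Rightarrow> 'v \<Rightarrow> real) \<Rightarrow> ('v \<Rightarrow> real) \<Rightarrow> 'v set \<Rightarrow> 'v set \<Rightarrow> real^'v"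
  where
  "influenced_steady_state E w \<kappa> S\<^sub>0 S\<^sub>1 =
     (let S = S\<^sub>0 \<union> S\<^sub>1; L = laplacian E w; K = diag_matrix \<kappa>
      in matrix_inv (L + indicator_matrix S ** K) *v ((indicator_matrix S\<^sub>1 ** K) *v (\<chi> v. 1)))"

definition average_opinion :: "real^'v::finite \<Rightarrow> real" where
  "average_opinion x = (1 / real CARD('v)) * (\<Sum>v\<in>UNIV. x $ v)"

definition absolute_mu ::
    "('v::finite \<times> 'v) set \<Rightarrow> ('v \<Rightarrow> 'v \<Rightarrow> real) \<Rightarrow> 'v set \<Rightarrow> 'v set \<Rightarrow> real" where
  "absolute_mu E w S\<^sub>0 S\<^sub>1 = average_opinion (absolute_steady_state E w S\<^sub>0 S\<^sub>1)"

definition influenced_mu ::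
    "('v::finite \<times> 'v) set \<Rightarrow> ('v \<Rightarrow> 'v \<Rightarrow> real) \<Rightarrow> ('v \<Rightarrow> real) \<Rightarrow> 'v set \<Rightarrow> 'v set \<Rightarrow> real"
  where
  "influenced_mu E w \<kappa> S\<^sub>0 S\<^sub>1 = average_opinion (influenced_steady_state E w \<kappa> S\<^sub>0 S\<^sub>1)"

end

theory Submission imports Defs begin

text \<open>
  Both systems are instances of one boundary value problem: \<open>(L x)\<^sub>v = 0\<close> at followers and
  \<open>a (L x)\<^sub>v + \<kappa>\<^sub>v (x\<^sub>v - t\<^sub>v) = 0\<close> at leaders, where \<open>t\<^sub>v\<close> is the leader's own opinion; the absolute
  system is the case \<open>a = 0\<close>, \<open>\<kappa> = 1\<close> and the influenced one is \<open>a = 1\<close>.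
  At a negative minimum of \<open>y\<close> one has \<open>(L y)\<^sub>v \<le> 0\<close>, and equality propagates the minimum along
  arcs; by strong connectivity it would reach a leader. Hence \<open>y \<ge> 0\<close> whenever the left-hand
  sides with \<open>t = 0\<close> are nonnegative. This minimum principle gives \<open>x \<le> 1\<close> and unique solvability,
  and applied to first and second differences of the steady states in \<open>S\<^sub>1\<close>, it gives
  monotonicity and submodularity at every single node.
\<close>

section \<open>Action of the Laplacian and matrix inverses\<close>

lemma diag_matrix_vec: "(diag_matrix f *v x) $ v = f v * x $ v"
  by (simp add: diag_matrix_def matrix_vector_mult_def if_distrib[of "\<lambda>c. c * _"] cong: if_cong)

text \<open>Distributing the degree over the row of adjacencies leaves only differences of values,
  whose signs are known at a minimum.\<close>

lemma laplacian_vec: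
  "(laplacian E w *v x) $ v = (\<Sum>u\<in>UNIV. adjacency E w $ v $ u * (x $ v - x $ u))"
proof -
  have "(laplacian E w *v x) $ v =
      (diag_matrix (\<lambda>u. \<Sum>j\<in>UNIV. adjacency E w $ u $ j) *v x) $ v - (adjacency E w *v x) $ v"
    by (simp add: laplacian_def out_degree_matrix_def matrix_vector_mult_diff_rdistrib)
  also have "\<dots> = (\<Sum>u\<in>UNIV. adjacency E w $ v $ u) * x $ v
      - (\<Sum>u\<in>UNIV. adjacency E w $ v $ u * x $ u)"
    by (simp only: diag_matrix_vec) (simp add: matrix_vector_mult_def)
  finally show ?thesis
    by (simp add: right_diff_distrib sum_subtractf sum_distrib_right)
qed

lemma laplacian_const: "laplacian E w *v (\<chi> v. c) = 0"
  by (simp add: vec_eq_iff laplacian_vec)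

lemma invertible_ker:
  fixes M :: "real^'n^'n"
  assumes "\<And>x. M *v x = 0 \<Longrightarrow> x = 0"
  shows "invertible M"
  using assms matrix_left_invertible_ker[of M] invertible_left_inverse[of M] by blast

lemma matrix_inv_left_right:
  assumes "invertible M"
  shows "M ** matrix_inv M = mat 1" "matrix_inv M ** M = mat 1"
  using someI_ex[OF assms[unfolded invertible_def]] unfolding matrix_inv_def by blast+

lemma matrix_inv_vec: "invertible M \<Longrightarrow> M *v (matrix_inv M *v b) = (b :: real^'n)"
  by (simp add: matrix_vector_mul_assoc matrix_inv_left_right)

text \<open>The target opinions are kept out of the operator, which makes it linear in
  \<open>x\<close>; they form the right-hand side in \<open>steady_state\<close>. Steady states for
  different leader sets can thus be subtracted and tested with one common operator.\<close>

definition boundary_op ::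
    "real \<Rightarrow> real^'v^'v \<Rightarrow> ('v::finite \<Rightarrow> real) \<Rightarrow> 'v set \<Rightarrow> real^'v \<Rightarrow> 'v \<Rightarrow> real" where
  "boundary_op a L \<kappa> S x v =
     (if v \<in> S then a * (L *v x) $ v + \<kappa> v * x $ v else (L *v x) $ v)"

definition steady_state ::
    "real \<Rightarrow> real^'v^'v \<Rightarrow> ('v::finite \<Rightarrow> real) \<Rightarrow> 'v set \<Rightarrow> 'v set \<Rightarrow> real^'v \<Rightarrow> bool" where
  "steady_state a L \<kappa> S\<^sub>0 S\<^sub>1 x \<longleftrightarrow>
     (\<forall>v. boundary_op a L \<kappa> (S\<^sub>0 \<union> S\<^sub>1) x v = (if v \<in> S\<^sub>1 then \<kappa> v else 0))"

section \<open>Minimum principle on a strongly connected graph\<close>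

locale leader_graph =
  fixes E :: "('v::finite \<times> 'v) set" and w :: "'v \<Rightarrow> 'v \<Rightarrow> real"
  assumes connected: "strongly_connected E"
    and weight_pos: "(u, v) \<in> E \<Longrightarrow> w u v > 0"
begin

abbreviation "L \<equiv> laplacian E w"

lemma adjacency_nonneg: "adjacency E w $ u $ v \<ge> 0"
  by (auto simp: adjacency_def dest: weight_pos intro: less_imp_le)

lemma laplacian_at_minimum:
  assumes "\<And>u. x $ v \<le> x $ u"
  shows "(L *v x) $ v \<le> 0"
  using assms adjacency_nonneg
  by (auto simp: laplacian_vec intro!: sum_nonpos mult_nonneg_nonpos)

text \<open>The terms \<open>A_{v,k} (x_k - x_v)\<close> are nonnegative and their sum
  \<open>- (L x)_v\<close> is at most 0, so each of them vanishes; on an arc the weight is positive,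
  so the difference is zero.\<close>

lemma minimum_spreads:
  assumes min: "\<And>u. x $ v \<le> x $ u" and L: "(L *v x) $ v \<ge> 0" and arc: "(v, u) \<in> E"
  shows "x $ u = x $ v"
proof -
  have nonneg: "adjacency E w $ v $ k * (x $ k - x $ v) \<ge> 0" for k
    using min adjacency_nonneg by simp
  have "(\<Sum>k\<in>UNIV. adjacency E w $ v $ k * (x $ k - x $ v)) = - (L *v x) $ v"
    unfolding laplacian_vec sum_negf[symmetric] by (intro sum.cong) (auto simp: algebra_simps)
  then have "(\<Sum>k\<in>UNIV. adjacency E w $ v $ k * (x $ k - x $ v)) = 0"
    using L sum_nonneg[of UNIV "\<lambda>k. adjacency E w $ v $ k * (x $ k - x $ v)"] nonneg by simp
  then have "adjacency E w $ v $ u * (x $ u - x $ v) = 0"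
    using nonneg by (subst (asm) sum_nonneg_eq_0_iff) auto
  with weight_pos[OF arc] arc show ?thesis by (simp add: adjacency_def)
qed

lemma minimum_principle:
  assumes a: "a \<ge> 0" and \<kappa>: "\<And>v. \<kappa> v > 0" and S: "S \<noteq> {}"
    and op: "\<And>v. boundary_op a L \<kappa> S x v \<ge> 0"
  shows "x $ v \<ge> 0"
proof (rule ccontr)
  assume neg: "\<not> x $ v \<ge> 0"
  obtain m where m: "\<And>u. x $ m \<le> x $ u"
    using ex_min_if_finite[of "range (($) x)"] by (auto simp: not_less)
  have xm: "x $ m < 0" using m[of v] neg by simp
  \<comment> \<open>A leader cannot attain the negative minimum: the Laplacian term is at most 0
    there, and the stubbornness term is strictly negative even when \<open>a = 0\<close>.\<close>
  have no_leader: "k \<notin> S" if k: "x $ k = x $ m" for k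
  proof
    assume "k \<in> S"
    then have "a * (L *v x) $ k + \<kappa> k * x $ k \<ge> 0" using op[of k] by (simp add: boundary_op_def)
    moreover have "a * (L *v x) $ k \<le> 0"
      using a k m by (intro mult_nonneg_nonpos laplacian_at_minimum) auto
    moreover have "\<kappa> k * x $ k < 0" using \<kappa> k xm by (simp add: mult_pos_neg)
    ultimately show False by simp
  qed
  obtain s where s: "s \<in> S" using S by blast
  have "(m, s) \<in> E\<^sup>*" using connected by (simp add: strongly_connected_def)
  \<comment> \<open>Each node reached on the way carries the minimum, hence is a follower; there the
    operator is \<open>L\<close> itself, so the minimum passes to the next node.\<close>
  then have "x $ s = x $ m"
  proof (induction rule: rtrancl_induct)
    case (step k l)
    then have "(L *v x) $ k \<ge> 0" using op[of k] no_leader[of k] by (simp add: boundary_op_def)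
    then show ?case using minimum_spreads[of x k l] m step by simp
  qed simp
  then show False using no_leader s by blast
qed

text \<open>By linearity the minimum principle applies to both \<open>x\<close> and
  \<open>- x\<close>. The invertibility needed in either system comes from this.\<close>

lemma boundary_op_ker:
  assumes "a \<ge> 0" "\<And>v. \<kappa> v > 0" "S \<noteq> {}" and op: "\<And>v. boundary_op a L \<kappa> S x v = 0"
  shows "x = 0"
proof -
  have neg: "boundary_op a L \<kappa> S (- x) v = - boundary_op a L \<kappa> S x v" for v
    by (simp add: boundary_op_def vec.neg)
  have "x $ v \<ge> 0" "(- x) $ v \<ge> 0" for v
    by (rule minimum_principle[of a \<kappa> S, OF assms(1-3)]; simp add: neg op)+
  then show ?thesis by (simp add: vec_eq_iff order_antisym)
qed

section \<open>Invertibility of the follower block\<close>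

lemma block_inverse_exists:
  assumes F: "F \<noteq> UNIV"
  shows "is_block_inverse F L (block_inverse F L)"
proof -
  \<comment> \<open>\<open>M\<close> is block diagonal, with the block of \<open>L\<close> on
    \<open>F\<close> and the identity elsewhere, so that a block inverse can be read off from the
    inverse of a full matrix.\<close>
  define M :: "real^'v^'v" where
    "M = (\<chi> i j. if i \<in> F \<and> j \<in> F then L $ i $ j else if i = j then 1 else 0)"
  have "invertible M"
  proof (rule invertible_ker)
    fix x assume 0: "M *v x = 0"
    have off: "x $ i = 0" if "i \<notin> F" for i
    proof -
      have "(M *v x) $ i = x $ i"
        using that
        by (simp add: M_def matrix_vector_mult_def if_distrib[of "\<lambda>c. c * _"] cong: if_cong)
      then show ?thesis using 0 by simp
    qed
    have on: "(L *v x) $ i = 0" if "i \<in> F" for i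
    proof -
      have "(L *v x) $ i = (M *v x) $ i"
        using that off by (auto simp: M_def matrix_vector_mult_def intro!: sum.cong)
      then show ?thesis using 0 by simp
    qed
    show "x = 0"
      \<comment> \<open>A kernel vector solves the homogeneous problem with leader set
        \<open>- F\<close>, which is nonempty since \<open>F \<noteq> UNIV\<close>; with
        \<open>a = 0\<close> and \<kappa> = 1 the leader condition just says that \<open>x\<close>
        vanishes there.\<close>
      using F off on by (intro boundary_op_ker[of 0 "\<lambda>_. 1" "- F"]) (auto simp: boundary_op_def)
  qed
  then have inv: "M ** matrix_inv M = mat 1" "matrix_inv M ** M = mat 1"
    by (simp_all add: matrix_inv_left_right)
  define N :: "real^'v^'v" where
    "N = (\<chi> i j. if i \<in> F \<and> j \<in> F then matrix_inv M $ i $ j else 0)"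
  have "(\<Sum>k\<in>F. L $ i $ k * N $ k $ j) = (if i = j then 1 else 0)"
    "(\<Sum>k\<in>F. N $ i $ k * L $ k $ j) = (if i = j then 1 else 0)" if "i \<in> F" "j \<in> F" for i j
  proof -
    \<comment> \<open>Here and in the second identity, the terms with \<open>k \<notin> F\<close>
      vanish because the off-diagonal blocks of \<open>M\<close> are zero.\<close>
    have "(\<Sum>k\<in>F. L $ i $ k * N $ k $ j) = (M ** matrix_inv M) $ i $ j"
      using that unfolding matrix_matrix_mult_def
      by (auto simp: M_def N_def intro!: sum.mono_neutral_cong_left)
    then show "(\<Sum>k\<in>F. L $ i $ k * N $ k $ j) = (if i = j then 1 else 0)"
      by (simp only: inv) (simp add: mat_def)
    have "(\<Sum>k\<in>F. N $ i $ k * L $ k $ j) = (matrix_inv M ** M) $ i $ j"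
      using that unfolding matrix_matrix_mult_def
      by (auto simp: M_def N_def intro!: sum.mono_neutral_cong_left)
    then show "(\<Sum>k\<in>F. N $ i $ k * L $ k $ j) = (if i = j then 1 else 0)"
      by (simp only: inv) (simp add: mat_def)
  qed
  then have "is_block_inverse F L N" by (auto simp: is_block_inverse_def N_def)
  then show ?thesis using block_inverse_eq by metis
qed

text \<open>Swapping the sums isolates the product of \<open>L\<close> and its block inverse over
  \<open>F\<close>, which is the identity there.\<close>

lemma block_inverse_solves:
  assumes "F \<noteq> UNIV" and i: "i \<in> F"
  shows "(\<Sum>k\<in>F. L $ i $ k * block_mult_vec (block_inverse F L) F F b $ k) = b $ i"
proof -
  let ?N = "block_inverse F L"
  have "(\<Sum>k\<in>F. L $ i $ k * block_mult_vec ?N F F b $ k)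
      = (\<Sum>k\<in>F. L $ i $ k * (\<Sum>j\<in>F. ?N $ k $ j * b $ j))"
    by (simp add: block_mult_vec_def)
  also have "\<dots> = (\<Sum>j\<in>F. (\<Sum>k\<in>F. L $ i $ k * ?N $ k $ j) * b $ j)"
    unfolding sum_distrib_left sum_distrib_right by (subst sum.swap) (simp add: mult.assoc)
  also have "\<dots> = (\<Sum>j\<in>F. if i = j then b $ j else 0)"
    using block_inverse_exists[OF assms(1)] i
    by (intro sum.cong) (auto simp: is_block_inverse_def)
  finally show ?thesis using i by simp
qed

section \<open>Both systems as boundary value problems\<close>

lemma absolute_steady_state:
  assumes S\<^sub>0: "S\<^sub>0 \<noteq> {}" "S\<^sub>0 \<inter> S\<^sub>1 = {}"
  shows "steady_state 0 L (\<lambda>_. 1) S\<^sub>0 S\<^sub>1 (absolute_steady_state E w S\<^sub>0 S\<^sub>1)"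
proof -
  define S where "S = S\<^sub>0 \<union> S\<^sub>1"
  define b where "b = block_mult_vec L (- S) S (leader_values S\<^sub>1)"
  define y where "y = block_mult_vec (block_inverse (- S) L) (- S) (- S) b"
  define x where "x = absolute_steady_state E w S\<^sub>0 S\<^sub>1"
  have x: "x $ v = (if v \<in> S then leader_values S\<^sub>1 $ v else - y $ v)" for v
    by (simp add: x_def absolute_steady_state_def Let_def S_def y_def b_def Compl_eq_Diff_UNIV)
  have "(L *v x) $ v = 0" if v: "v \<notin> S" for v
  proof -
    \<comment> \<open>The leader part of the row is \<open>b $ v\<close> by the choice of
      \<open>b\<close>; the follower part is \<open>- b $ v\<close> because \<open>y\<close> solves
      the block system with right-hand side \<open>b\<close>.\<close>
    have "(L *v x) $ v = (\<Sum>k\<in>S. L $ v $ k * x $ k) + (\<Sum>k\<in>- S. L $ v $ k * x $ k)"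
      unfolding matrix_vector_mult_def
      by (simp add: sum.union_disjoint[symmetric] Compl_partition)
    also have "(\<Sum>k\<in>S. L $ v $ k * x $ k) = b $ v"
      using v by (simp add: b_def block_mult_vec_def x)
    also have "(\<Sum>k\<in>- S. L $ v $ k * x $ k) = - (\<Sum>k\<in>- S. L $ v $ k * y $ k)"
      unfolding sum_negf[symmetric] by (intro sum.cong) (auto simp: x)
    also have "\<dots> = - b $ v"
      using v S\<^sub>0 unfolding y_def by (subst block_inverse_solves) (auto simp: S_def)
    finally show ?thesis by simp
  qed
  then show ?thesis
    unfolding x_def[symmetric] steady_state_def boundary_op_def
    by (auto simp: S_def x leader_values_def)
qed

text \<open>The system matrix acts exactly as \<open>boundary_op\<close> with \<open>a = 1\<close>,
  so its trivial kernel makes \<open>matrix_inv\<close> a true inverse, and the forcing vector is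
  the right-hand side of \<open>steady_state\<close>.\<close>

lemma influenced_steady_state:
  assumes \<kappa>: "\<And>v. \<kappa> v > 0" and S\<^sub>0: "S\<^sub>0 \<noteq> {}"
  shows "steady_state 1 L \<kappa> S\<^sub>0 S\<^sub>1 (influenced_steady_state E w \<kappa> S\<^sub>0 S\<^sub>1)"
proof -
  have diag: "((indicator_matrix T ** diag_matrix \<kappa>) *v x) $ v = (if v \<in> T then \<kappa> v * x $ v else 0)"
    for T x v
    by (simp add: matrix_vector_mul_assoc[symmetric] indicator_matrix_def diag_matrix_vec)
  define M where "M = L + indicator_matrix (S\<^sub>0 \<union> S\<^sub>1) ** diag_matrix \<kappa>"
  have M: "(M *v x) $ v = boundary_op 1 L \<kappa> (S\<^sub>0 \<union> S\<^sub>1) x v" for x v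
    by (simp add: M_def matrix_vector_mult_add_rdistrib diag boundary_op_def)
  have "invertible M"
  proof (rule invertible_ker)
    fix x assume "M *v x = 0"
    then have "boundary_op 1 L \<kappa> (S\<^sub>0 \<union> S\<^sub>1) x v = 0" for v using M[of x v] by simp
    then show "x = 0" using \<kappa> S\<^sub>0 by (intro boundary_op_ker[of 1 \<kappa> "S\<^sub>0 \<union> S\<^sub>1"]) auto
  qed
  then have "M *v influenced_steady_state E w \<kappa> S\<^sub>0 S\<^sub>1
      = (indicator_matrix S\<^sub>1 ** diag_matrix \<kappa>) *v (\<chi> v. 1)"
    unfolding influenced_steady_state_def Let_def M_def[symmetric] by (rule matrix_inv_vec)
  then show ?thesis unfolding steady_state_def M[symmetric] by (simp add: diag)
qed

section \<open>Comparison of steady states\<close>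

context
  fixes a :: real and \<kappa> :: "'v \<Rightarrow> real" and S\<^sub>0 :: "'v set"
  assumes a: "a \<ge> 0" and \<kappa>: "\<And>v. \<kappa> v > 0" and S\<^sub>0: "S\<^sub>0 \<noteq> {}"
begin

text \<open>The minimum principle applies to \<open>1 - x\<close>: since \<open>L\<close> kills
  constants, the operator gives \<open>\<kappa> k\<close> at leaders outside
  \<open>S\<^sub>1\<close> and 0 at all other nodes.\<close>

lemma steady_state_le_1:
  assumes "steady_state a L \<kappa> S\<^sub>0 S\<^sub>1 x"
  shows "x $ v \<le> 1"
proof -
  let ?y = "(\<chi> v. 1) - x"
  have "boundary_op a L \<kappa> (S\<^sub>0 \<union> S\<^sub>1) ?y k \<ge> 0" for k
    using assms[unfolded steady_state_def, rule_format, of k] \<kappa>[of k]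
    by (auto simp: boundary_op_def matrix_vector_mult_diff_distrib laplacian_const algebra_simps
        split: if_splits)
  then have "?y $ v \<ge> 0" using S\<^sub>0 by (intro minimum_principle[of a \<kappa> "S\<^sub>0 \<union> S\<^sub>1", OF a \<kappa>]) auto
  then show ?thesis by simp
qed

text \<open>The difference \<open>y - x\<close> is tested with the larger leader set. At a node of
  \<open>T\<^sub>1 - S\<^sub>1\<close> the state \<open>x\<close> obeys the follower equation, so
  the operator gives \<open>\<kappa> k - \<kappa> k * x $ k\<close>, nonnegative because
  \<open>x \<le> 1\<close>; elsewhere it gives 0.\<close>

lemma steady_state_mono:
  assumes x: "steady_state a L \<kappa> S\<^sub>0 S\<^sub>1 x" and y: "steady_state a L \<kappa> S\<^sub>0 T\<^sub>1 y"
    and sub: "S\<^sub>1 \<subseteq> T\<^sub>1" "S\<^sub>0 \<inter> T\<^sub>1 = {}"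
  shows "x $ v \<le> y $ v"
proof -
  have "boundary_op a L \<kappa> (S\<^sub>0 \<union> T\<^sub>1) (y - x) k \<ge> 0" for k
  proof -
    have "\<kappa> k * x $ k \<le> \<kappa> k" using \<kappa>[of k] steady_state_le_1[OF x] by simp
    then show ?thesis
      using x[unfolded steady_state_def, rule_format, of k]
        y[unfolded steady_state_def, rule_format, of k] sub
      by (auto simp: boundary_op_def matrix_vector_mult_diff_distrib algebra_simps
          split: if_splits)
  qed
  then have "(y - x) $ v \<ge> 0" using S\<^sub>0 by (intro minimum_principle[of a \<kappa> "S\<^sub>0 \<union> T\<^sub>1", OF a \<kappa>]) auto
  then show ?thesis by simp
qed

text \<open>The second difference \<open>?d\<close> is tested with the largest of the four leader
  sets. The operator vanishes on \<open>S\<^sub>0\<close>, on \<open>S\<^sub>1\<close> and at the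
  common followers, so only \<open>T\<^sub>1 - S\<^sub>1\<close> and \<open>u\<close> remain;
  monotonicity settles both.\<close>

lemma steady_state_submodular:
  assumes x: "steady_state a L \<kappa> S\<^sub>0 S\<^sub>1 x" and y: "steady_state a L \<kappa> S\<^sub>0 T\<^sub>1 y"
    and x': "steady_state a L \<kappa> S\<^sub>0 (S\<^sub>1 \<union> {u}) x'" and y': "steady_state a L \<kappa> S\<^sub>0 (T\<^sub>1 \<union> {u}) y'"
    and sub: "S\<^sub>1 \<subseteq> T\<^sub>1" "S\<^sub>0 \<inter> T\<^sub>1 = {}" "u \<notin> S\<^sub>0 \<union> T\<^sub>1"
  shows "y' $ v - y $ v \<le> x' $ v - x $ v"
proof -
  let ?d = "(x' - x) - (y' - y)"
  have "boundary_op a L \<kappa> (S\<^sub>0 \<union> (T\<^sub>1 \<union> {u})) ?d k \<ge> 0" for k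
  proof -
    \<comment> \<open>Nodes of \<open>T\<^sub>1 - S\<^sub>1\<close> are leaders for \<open>y\<close>
      and \<open>y'\<close> only; there the operator gives
      \<open>\<kappa> k * (x' $ k - x $ k)\<close>.\<close>
    have "\<kappa> k * x $ k \<le> \<kappa> k * x' $ k"
      using \<kappa>[of k] steady_state_mono[OF x x'] sub by auto
    \<comment> \<open>The node \<open>u\<close> is a leader for \<open>x'\<close> and
      \<open>y'\<close> only; there the operator gives
      \<open>\<kappa> k * (y $ k - x $ k)\<close>.\<close>
    moreover have "\<kappa> k * x $ k \<le> \<kappa> k * y $ k"
      using \<kappa>[of k] sub by (simp add: steady_state_mono[OF x y])
    ultimately show ?thesis
      using x[unfolded steady_state_def, rule_format, of k]
        y[unfolded steady_state_def, rule_format, of k]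
        x'[unfolded steady_state_def, rule_format, of k]
        y'[unfolded steady_state_def, rule_format, of k] sub
      by (auto simp: boundary_op_def matrix_vector_mult_diff_distrib algebra_simps
          split: if_splits)
  qed
  then have "?d $ v \<ge> 0" using S\<^sub>0 by (intro minimum_principle[of a \<kappa> "S\<^sub>0 \<union> (T\<^sub>1 \<union> {u})", OF a \<kappa>]) auto
  then show ?thesis by simp
qed

text \<open>Averaging preserves the nodewise inequalities. Taking \<open>x\<close> to be any family
  of steady states lets both systems be instances.\<close>

lemma average_opinion_mono_submodular:
  assumes st: "\<And>S\<^sub>1. S\<^sub>0 \<inter> S\<^sub>1 = {} \<Longrightarrow> steady_state a L \<kappa> S\<^sub>0 S\<^sub>1 (x S\<^sub>1)"
    and sub: "S\<^sub>1 \<subseteq> T\<^sub>1" "T\<^sub>1 \<subseteq> UNIV - S\<^sub>0"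
  shows "average_opinion (x S\<^sub>1) \<le> average_opinion (x T\<^sub>1) \<and>
    (\<forall>u \<in> UNIV - (S\<^sub>0 \<union> T\<^sub>1).
       average_opinion (x (T\<^sub>1 \<union> {u})) - average_opinion (x T\<^sub>1)
         \<le> average_opinion (x (S\<^sub>1 \<union> {u})) - average_opinion (x S\<^sub>1))"
proof (intro conjI ballI)
  have disj: "S\<^sub>0 \<inter> S\<^sub>1 = {}" "S\<^sub>0 \<inter> T\<^sub>1 = {}" using sub by auto
  show "average_opinion (x S\<^sub>1) \<le> average_opinion (x T\<^sub>1)"
    unfolding average_opinion_def
    using disj sub by (intro mult_left_mono sum_mono steady_state_mono[OF st st]) auto
  fix u assume u: "u \<in> UNIV - (S\<^sub>0 \<union> T\<^sub>1)"
  then have disj': "S\<^sub>0 \<inter> (S\<^sub>1 \<union> {u}) = {}" "S\<^sub>0 \<inter> (T\<^sub>1 \<union> {u}) = {}" using disj by auto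
  show "average_opinion (x (T\<^sub>1 \<union> {u})) - average_opinion (x T\<^sub>1)
      \<le> average_opinion (x (S\<^sub>1 \<union> {u})) - average_opinion (x S\<^sub>1)"
    \<comment> \<open>Pulling out the common factor and merging the sums reduces the claim to a
      comparison node by node.\<close>
    unfolding average_opinion_def right_diff_distrib[symmetric] sum_subtractf[symmetric]
    using u disj sub
    by (intro mult_left_mono sum_mono
        steady_state_submodular[OF st st st st, OF disj disj']) auto
qed

end

end

theorem mainTheorem7:
  fixes E :: "('v::finite \<times> 'v) set"
    and w :: "'v \<Rightarrow> 'v \<Rightarrow> real"
    and \<kappa> :: "'v \<Rightarrow> real"
    and S\<^sub>0 :: "'v set"
  assumes "strongly_connected E"
    and "\<And>u v. (u, v) \<in> E \<Longrightarrow> w u v > 0"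
    and "\<And>v. \<kappa> v > 0"
    and "S\<^sub>0 \<noteq> {}"
  shows
    "(\<forall>S\<^sub>1 T\<^sub>1. S\<^sub>1 \<subseteq> T\<^sub>1 \<and> T\<^sub>1 \<subseteq> UNIV - S\<^sub>0 \<longrightarrow>
        absolute_mu E w S\<^sub>0 S\<^sub>1 \<le> absolute_mu E w S\<^sub>0 T\<^sub>1 \<and>
        (\<forall>u \<in> UNIV - (S\<^sub>0 \<union> T\<^sub>1).
           absolute_mu E w S\<^sub>0 (T\<^sub>1 \<union> {u}) - absolute_mu E w S\<^sub>0 T\<^sub>1
             \<le> absolute_mu E w S\<^sub>0 (S\<^sub>1 \<union> {u}) - absolute_mu E w S\<^sub>0 S\<^sub>1)) \<and>
     (\<forall>S\<^sub>1 T\<^sub>1. S\<^sub>1 \<subseteq> T\<^sub>1 \<and> T\<^sub>1 \<subseteq> UNIV - S\<^sub>0 \<longrightarrow>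
        influenced_mu E w \<kappa> S\<^sub>0 S\<^sub>1 \<le> influenced_mu E w \<kappa> S\<^sub>0 T\<^sub>1 \<and>
        (\<forall>u \<in> UNIV - (S\<^sub>0 \<union> T\<^sub>1).
           influenced_mu E w \<kappa> S\<^sub>0 (T\<^sub>1 \<union> {u}) - influenced_mu E w \<kappa> S\<^sub>0 T\<^sub>1
             \<le> influenced_mu E w \<kappa> S\<^sub>0 (S\<^sub>1 \<union> {u}) - influenced_mu E w \<kappa> S\<^sub>0 S\<^sub>1))"
proof -
  interpret leader_graph E w using assms(1,2) by unfold_locales
  note general = average_opinion_mono_submodular[OF _ _ assms(4)]
  show ?thesis
    unfolding absolute_mu_def influenced_mu_def
    by (intro conjI[OF allI[OF allI[OF impI]] allI[OF allI[OF impI]]]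
        general[of 0 "\<lambda>_. 1"] general[of 1 \<kappa>] absolute_steady_state influenced_steady_state assms)
      auto
qed

end
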